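(* Let $\bar{\mathrm{G}}=(\mathrm{V},\mathrm{E},\mathtt{d})$ be an exponential distance graph of a walking cat, and let $\mathrm{U}_1,\dots,\mathrm{U}_r$ be pairwise disjoint nonempty subsets of $\mathrm{V}$, each connected by a corridor. Let $\mathrm{V}_1,\dots,\mathrm{V}_s$, with $s=\sum_{i\in[r]}\#\mathrm{U}_i-r+1$, be a partition of $\mathrm{V}$ such that for every $l\in[s]$: there exists $i\in[r]$ with $\mathrm{U}_i\cap\mathrm{V}_l\ne\emptyset$ and $\#(\mathrm{U}_i\cap\mathrm{V}_l)\le1$ for all $i$; and if $A,B\in\mathrm{V}_l$, $A\ne B$, $(A=A_1,\dots,A_k=B)\in\mathscr{M}(A,B)$, then $A_1,\dots,A_k\in\mathrm{V}_l$. Assume that for every $i\in[r]$ there is a real variable $q_i$ such that $\mathtt{d}(A,B)=q_i$ for all $A,B\in\mathrm{U}_i$ with $A\ne B$. Let $\mathsf{D}_{\bar{\mathrm{G}}}=(\mathtt{d}(B,A))_{A,B\in\mathrm{V}}$ and $\mathsf{D}_{\bar{\mathrm{G}}_k}=(\mathtt{d}(B,A))_{A,B\in\mathrm{V}_k}$ for $k\in[s]$. Then $$\det\mathsf{D}_{\bar{\mathrm{G}}}=\prod_{i\in[r]}\big(1+(\#\mathrm{U}_i-1)q_i\big)(1-q_i)^{\#\mathrm{U}_i-1}\prod_{k\in[s]}\det\mathsf{D}_{\bar{\mathrm{G}}_k}.$$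
   Context: All graphs have finite vertex set $\mathrm{V}$ and edge set $\mathrm{E}\subseteq\mathrm{V}^2$. For $A,B\in\mathrm{V}$, $\mathscr{S}(A,B)$ is the set of vertex sequences $(A=A_1,\dots,A_k=B)$ with $(A_i,A_{i+1})\in\mathrm{E}$; connected means $\mathscr{S}(A,B)\ne\emptyset$ for all $A,B$. $\mathrm{l}(A,B)=\min\{k\mid(A_1,\dots,A_k)\in\mathscr{S}(A,B)\}$, $\mathrm{l}(A,A)=0$, and $\mathscr{M}(A,B)=\{(A_1,\dots,A_k)\in\mathscr{S}(A,B)\mid k=\mathrm{l}(A,B)\}$. A probabilistic graph of a walking cat is a connected digraph $(\mathrm{V},\mathrm{E},\mathtt{p})$ with all loops in $\mathrm{E}$ and $\mathtt{p}:\mathrm{V}^2\to[0,1]$ such that for $A\ne B$: $\sum_{A'}\mathtt{p}(A,A')=1$; any two sequences in $\mathscr{M}(A,B)$ have equal multisets $\{\mathtt{p}(A_i,A_{i+1})\}$; and $\mathtt{p}(A,B)=\prod_{i\in[k-1]}\mathtt{p}(A_i,A_{i+1})$ for $(A_1,\dots,A_k)\in\mathscr{M}(A,B)$. Let $\mathbb{M}_n$ be the set of monomials of $\mathbb{R}[x_1,\dots,x_n]$. A function $\mathtt{d}:\mathrm{V}^2\to\mathbb{M}_n$ is an exponential distance on $\mathrm{G}=(\mathrm{V},\mathrm{E},\mathtt{p})$ if $\mathtt{d}(A,A)=1$ and, for $A\ne B$, any two sequences in $\mathscr{M}(A,B)$ have equal multisets $\{\mathtt{d}(A_i,A_{i+1})\}$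 and $\mathtt{d}(A,B)=\prod_{i\in[k-1]}\mathtt{d}(A_i,A_{i+1})$ for $(A_1,\dots,A_k)\in\mathscr{M}(A,B)$. An exponential distance graph of a walking cat is $\bar{\mathrm{G}}=(\mathrm{V},\mathrm{E},\mathtt{d})$ with $\mathtt{d}$ an exponential distance on a probabilistic graph of a walking cat $(\mathrm{V},\mathrm{E},\mathtt{p})$ to which it is dual, i.e. $\mathtt{p}(A,B)=\mathtt{d}(A,B)/\sum_{C\in\mathrm{V}}\mathtt{d}(A,C)$ for all $A,B$. A nonempty $\mathrm{U}\subseteq\mathrm{V}$ is connected by a corridor if $\mathrm{V}$ can be partitioned into $\#\mathrm{U}$ sets $\mathrm{W}_1,\dots,\mathrm{W}_{\#\mathrm{U}}$ such that for $i,j$: $\mathrm{W}_i\cap\mathrm{U}=\{C_i\}$ and $(C_i,C_j)\in\mathrm{E}$; minimal sequences between distinct vertices of $\mathrm{W}_i$ stay in $\mathrm{W}_i$; and if $i\ne j$, $(A,B)\in\mathrm{W}_i\times\mathrm{W}_j$, $(A_1,\dots,A_k)\in\mathscr{M}(A,C_i)$, $(B_1,\dots,B_l)\in\mathscr{M}(C_j,B)$, then the concatenation $(A_1,\dots,A_k,B_1,\dots,B_l)\in\mathscr{M}(A,B)$.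
   Formalization: The minimal sequences from a vertex A to itself are taken to be the single sequence (A), not the empty set that l(A,A)=0 would give, since the claim fails otherwise; the duality between p and d is read as holding at some real values of the variables. *)

theory Defs
  imports
    "HOL-Analysis.Determinants"
    "HOL-Library.Poly_Mapping"
    "HOL-Library.Multiset"
    "HOL-Library.Disjoint_Sets"
begin

(* Real polynomials in variables indexed by nat; R[x_1,...,x_n] consists of those
   in which only the variables with index in {1..n} occur. *)
type_synonym rpoly = "(nat \<Rightarrow>\<^sub>0 nat) \<Rightarrow>\<^sub>0 real"

definition variables :: "nat \<Rightarrow> rpoly set" where
  "variables n = {Poly_Mapping.single (Poly_Mapping.single j 1) 1 | j. j \<in> {1..n}}"

(* A monomial is c * x_1^a_1 * ... * x_n^a_n with c a nonzero real. *)
definition monomials :: "nat \<Rightarrow> rpoly set" where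
  "monomials n = {Poly_Mapping.single a c | a c. Poly_Mapping.keys a \<subseteq> {1..n} \<and> c \<noteq> 0}"

definition poly_value :: "(nat \<Rightarrow> real) \<Rightarrow> rpoly \<Rightarrow> real" where
  "poly_value x P =
     (\<Sum>a\<in>Poly_Mapping.keys P. Poly_Mapping.lookup P a *
        (\<Prod>j\<in>Poly_Mapping.keys a. x j ^ Poly_Mapping.lookup a j))"

(* Leibniz determinant of a square matrix whose rows and columns are indexed by a finite set. *)
definition det_on :: "'v set \<Rightarrow> ('v \<Rightarrow> 'v \<Rightarrow> 'a::comm_ring_1) \<Rightarrow> 'a" where
  "det_on S M = (\<Sum>p | p permutes S. of_int (sign p) * (\<Prod>i\<in>S. M i (p i)))"

lemma det_on_UNIV:
  fixes M :: "'v::finite \<Rightarrow> 'v \<Rightarrow> 'a::comm_ring_1"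
  shows "det_on UNIV M = det (\<chi> i j. M i j)"
  by (simp add: det_on_def det_def)

definition seqs :: "'v set \<Rightarrow> ('v \<times> 'v) set \<Rightarrow> 'v \<Rightarrow> 'v \<Rightarrow> 'v list set" where
  "seqs V E A B = {xs. xs \<noteq> [] \<and> set xs \<subseteq> V \<and> hd xs = A \<and> last xs = B \<and>
                       successively (\<lambda>a b. (a, b) \<in> E) xs}"

(* Between distinct vertices this counts vertices, not edges. *)
definition min_len :: "'v set \<Rightarrow> ('v \<times> 'v) set \<Rightarrow> 'v \<Rightarrow> 'v \<Rightarrow> nat" where
  "min_len V E A B =
     (if A = B then 0 else (LEAST k. \<exists>xs\<in>seqs V E A B. length xs = k))"

(* The minimal sequence from a vertex to itself is the one-vertex sequence. It matters only
   in the concatenation clause of a corridor, where it makes (C_i, B_1, ..., B_l) and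
   (A_1, ..., A_k, C_j) minimal sequences. *)
definition min_seqs :: "'v set \<Rightarrow> ('v \<times> 'v) set \<Rightarrow> 'v \<Rightarrow> 'v \<Rightarrow> 'v list set" where
  "min_seqs V E A B =
     (if A = B then {[A]} else {xs \<in> seqs V E A B. length xs = min_len V E A B})"

definition connected_digraph :: "'v set \<Rightarrow> ('v \<times> 'v) set \<Rightarrow> bool" where
  "connected_digraph V E \<longleftrightarrow>
     finite V \<and> E \<subseteq> V \<times> V \<and> (\<forall>A\<in>V. \<forall>B\<in>V. seqs V E A B \<noteq> {})"

definition step_values :: "('v \<Rightarrow> 'v \<Rightarrow> 'b) \<Rightarrow> 'v list \<Rightarrow> 'b list" where
  "step_values f xs = map (\<lambda>i. f (xs ! i) (xs ! Suc i)) [0..<length xs - 1]"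

definition multiplicative_along_min_seqs ::
    "'v set \<Rightarrow> ('v \<times> 'v) set \<Rightarrow> ('v \<Rightarrow> 'v \<Rightarrow> 'b::comm_monoid_mult) \<Rightarrow> 'v \<Rightarrow> 'v \<Rightarrow> bool" where
  "multiplicative_along_min_seqs V E f A B \<longleftrightarrow>
     (\<forall>xs\<in>min_seqs V E A B. \<forall>ys\<in>min_seqs V E A B.
        mset (step_values f xs) = mset (step_values f ys)) \<and>
     (\<forall>xs\<in>min_seqs V E A B. f A B = prod_list (step_values f xs))"

definition prob_cat_graph :: "'v set \<Rightarrow> ('v \<times> 'v) set \<Rightarrow> ('v \<Rightarrow> 'v \<Rightarrow> real) \<Rightarrow> bool" where
  "prob_cat_graph V E p \<longleftrightarrow>
     connected_digraph V E \<and> (\<forall>A\<in>V. (A, A) \<in> E) \<and>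
     (\<forall>A\<in>V. \<forall>B\<in>V. 0 \<le> p A B \<and> p A B \<le> 1) \<and>
     (\<forall>A\<in>V. \<forall>B\<in>V. A \<noteq> B \<longrightarrow>
        (\<Sum>A'\<in>V. p A A') = 1 \<and> multiplicative_along_min_seqs V E p A B)"

definition exponential_distance ::
    "nat \<Rightarrow> 'v set \<Rightarrow> ('v \<times> 'v) set \<Rightarrow> ('v \<Rightarrow> 'v \<Rightarrow> rpoly) \<Rightarrow> bool" where
  "exponential_distance n V E d \<longleftrightarrow>
     (\<forall>A\<in>V. \<forall>B\<in>V. d A B \<in> monomials n) \<and>
     (\<forall>A\<in>V. d A A = 1) \<and>
     (\<forall>A\<in>V. \<forall>B\<in>V. A \<noteq> B \<longrightarrow> multiplicative_along_min_seqs V E d A B)"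

(* The entries of p are real numbers and those of d are monomials in real variables, so the
   quotient is taken at some assignment x of real values to the variables. *)
definition dual :: "'v set \<Rightarrow> ('v \<Rightarrow> 'v \<Rightarrow> real) \<Rightarrow> ('v \<Rightarrow> 'v \<Rightarrow> rpoly) \<Rightarrow> bool" where
  "dual V p d \<longleftrightarrow>
     (\<exists>x. \<forall>A\<in>V. (\<Sum>C\<in>V. poly_value x (d A C)) \<noteq> 0 \<and>
        (\<forall>B\<in>V. p A B = poly_value x (d A B) / (\<Sum>C\<in>V. poly_value x (d A C))))"

definition exp_dist_cat_graph ::
    "nat \<Rightarrow> 'v set \<Rightarrow> ('v \<times> 'v) set \<Rightarrow> ('v \<Rightarrow> 'v \<Rightarrow> rpoly) \<Rightarrow> bool" where
  "exp_dist_cat_graph n V E d \<longleftrightarrow>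
     (\<exists>p. prob_cat_graph V E p \<and> exponential_distance n V E d \<and> dual V p d)"

definition indexed_partition :: "'v set \<Rightarrow> nat \<Rightarrow> (nat \<Rightarrow> 'v set) \<Rightarrow> bool" where
  "indexed_partition V m W \<longleftrightarrow>
     (\<forall>i\<in>{1..m}. W i \<noteq> {}) \<and> disjoint_family_on W {1..m} \<and> (\<Union>i\<in>{1..m}. W i) = V"

definition min_seq_closed :: "'v set \<Rightarrow> ('v \<times> 'v) set \<Rightarrow> 'v set \<Rightarrow> bool" where
  "min_seq_closed V E W \<longleftrightarrow>
     (\<forall>A\<in>W. \<forall>B\<in>W. A \<noteq> B \<longrightarrow> (\<forall>xs\<in>min_seqs V E A B. set xs \<subseteq> W))"

definition connected_by_corridor :: "'v set \<Rightarrow> ('v \<times> 'v) set \<Rightarrow> 'v set \<Rightarrow> bool" where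
  "connected_by_corridor V E U \<longleftrightarrow>
     U \<noteq> {} \<and> U \<subseteq> V \<and>
     (\<exists>W C. indexed_partition V (card U) W \<and>
        (\<forall>i\<in>{1..card U}. W i \<inter> U = {C i} \<and> min_seq_closed V E (W i)) \<and>
        (\<forall>i\<in>{1..card U}. \<forall>j\<in>{1..card U}. (C i, C j) \<in> E) \<and>
        (\<forall>i\<in>{1..card U}. \<forall>j\<in>{1..card U}. i \<noteq> j \<longrightarrow>
           (\<forall>A\<in>W i. \<forall>B\<in>W j. \<forall>xs\<in>min_seqs V E A (C i). \<forall>ys\<in>min_seqs V E (C j) B.
              xs @ ys \<in> min_seqs V E A B)))"

end

theory Submission
  imports Defs "Jordan_Normal_Form.Determinant"
begin

text \<open>A corridor on \<open>U\<close> is a retraction \<open>w\<close> of \<open>V\<close> onto \<open>U\<close> such that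
  \<open>d A B = d A (w A) * q * d (w B) B\<close> whenever \<open>w A \<noteq> w B\<close>. Subtracting suitable multiples of the
  rows in \<open>U\<close> from the other rows makes the matrix block triangular, with one block on \<open>U\<close> and one
  on each fibre of \<open>w\<close> without its base point; hence the determinant is that of the \<open>U\<close>-block (ones on
  the diagonal, \<open>q\<close> elsewhere) times those of the fibres. This argument works inside every
  \<open>K \<supseteq> U\<close>, so corridors can be used one after the other: by disjointness, \<open>U j\<close> lies
  in a single fibre of the \<open>i\<close>-th retraction, and adding the \<open>i\<close>-th corridor splits only the joint
  fibre containing \<open>U i\<close>, into \<open>card (U i)\<close> pieces. Thus there are exactly \<open>s\<close> joint fibres. The
  parts \<open>P l\<close>, being closed under minimal sequences and meeting each \<open>U i\<close> at most once, lie in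
  joint fibres, and since there are also \<open>s\<close> of them they are the joint fibres.\<close>

section \<open>Leibniz determinants over finite index sets\<close>

text \<open>Conjugation by \<open>f\<close> carries the permutations of \<open>A\<close> to those of
  \<open>S\<close>, preserves signs and matches the two Leibniz products factor by factor.\<close>

lemma det_on_reindex:
  fixes M :: "'v \<Rightarrow> 'v \<Rightarrow> 'a::comm_ring_1"
  assumes f: "bij_betw f A S" and A: "finite A"
  shows "det_on S M = det_on A (\<lambda>i j. M (f i) (f j))"
proof -
  have inj: "inj_on f A" using f by (auto simp: bij_betw_def)
  have f': "bij_betw (inv_into A f) S A" using f by (rule bij_betw_inv_into)
  have "det_on A (\<lambda>i j. M (f i) (f j)) = det_on S M"
    unfolding det_on_def
  proof (rule sum.reindex_bij_witness[where j = "map_permutation A f"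
          and i = "map_permutation S (inv_into A f)"])
    fix p assume "p \<in> {p. p permutes A}"
    then have p: "p permutes A" by simp
    show "map_permutation S (inv_into A f) (map_permutation A f p) = p"
      by (rule map_permutation_compose_inv[OF f p]) (simp add: inj)
    show "map_permutation A f p \<in> {p. p permutes S}"
      using map_permutation_permutes[OF f p] by simp
    have "(\<Prod>i\<in>S. M i (map_permutation A f p i)) =
          (\<Prod>i\<in>A. M (f i) (map_permutation A f p (f i)))"
      by (rule prod.reindex_bij_betw[OF f, symmetric])
    also have "\<dots> = (\<Prod>i\<in>A. M (f i) (f (p i)))"
      by (intro prod.cong) (simp_all add: map_permutation_apply[OF inj])
    finally show "of_int (sign (map_permutation A f p)) *
        (\<Prod>i\<in>S. M i (map_permutation A f p i)) =
        of_int (sign p) * (\<Prod>i\<in>A. M (f i) (f (p i)))"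
      by (simp add: sign_map_permutation[OF inj p A])
  next
    fix p assume "p \<in> {p. p permutes S}"
    then have p: "p permutes S" by simp
    show "map_permutation A f (map_permutation S (inv_into A f) p) = p"
      using f by (intro map_permutation_compose_inv[OF f' p]) (auto simp: bij_betw_def f_inv_into_f)
    show "map_permutation S (inv_into A f) p \<in> {p. p permutes A}"
      using map_permutation_permutes[OF f' p] by simp
  qed
  then show ?thesis by simp
qed

text \<open>An enumeration of \<open>S\<close> turns \<open>det_on\<close> into the determinant of a
  matrix indexed by numbers. Multiplicativity and invariance under transposition are transferred
  along this bridge.\<close>

lemma det_on_eq_det_mat:
  fixes M :: "'v \<Rightarrow> 'v \<Rightarrow> 'a::comm_ring_1"
  assumes "bij_betw f {0..<n} S"
  shows "det_on S M = Determinant.det (mat n n (\<lambda>(i, j). M (f i) (f j)))"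
proof -
  have "det_on S M = det_on {0..<n} (\<lambda>i j. M (f i) (f j))"
    using assms by (rule det_on_reindex) simp
  also have "\<dots> = Determinant.det (mat n n (\<lambda>(i, j). M (f i) (f j)))"
    unfolding det_on_def
    by (subst det_def'[of _ n], simp)
       (intro sum.cong arg_cong2[of _ _ _ _ times] prod.cong refl,
        auto dest: permutes_in_image)
  finally show ?thesis .
qed

lemma det_on_cong:
  assumes "\<And>A B. A \<in> S \<Longrightarrow> B \<in> S \<Longrightarrow> M A B = N A B"
  shows "det_on S M = det_on S N"
  unfolding det_on_def
  by (intro sum.cong arg_cong2[of _ _ _ _ times] prod.cong refl)
     (use assms in \<open>auto simp: permutes_in_image\<close>)

lemma det_on_mult:
  fixes M N :: "'v \<Rightarrow> 'v \<Rightarrow> 'a::comm_ring_1"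
  assumes "finite S"
  shows "det_on S (\<lambda>A B. \<Sum>C\<in>S. M A C * N C B) = det_on S M * det_on S N"
proof -
  obtain f where f: "bij_betw f {0..<card S} S"
    using ex_bij_betw_nat_finite[OF assms] by blast
  let ?m = "\<lambda>M. mat (card S) (card S) (\<lambda>(i, j). M (f i) (f j)) :: 'a mat"
  have "?m (\<lambda>A B. \<Sum>C\<in>S. M A C * N C B) = ?m M * ?m N"
    by (rule eq_matI)
       (auto simp: scalar_prod_def sum.reindex_bij_betw[OF f, symmetric])
  then show ?thesis
    by (simp add: det_on_eq_det_mat[OF f] det_mult[of _ "card S"])
qed

lemma det_on_transpose:
  fixes M :: "'v \<Rightarrow> 'v \<Rightarrow> 'a::comm_ring_1"
  assumes "finite S"
  shows "det_on S (\<lambda>A B. M B A) = det_on S M"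
proof -
  obtain f where f: "bij_betw f {0..<card S} S"
    using ex_bij_betw_nat_finite[OF assms] by blast
  let ?m = "\<lambda>M. mat (card S) (card S) (\<lambda>(i, j). M (f i) (f j)) :: 'a mat"
  have "?m (\<lambda>A B. M B A) = transpose_mat (?m M)"
    by (rule eq_matI) auto
  then show ?thesis
    by (simp add: det_on_eq_det_mat[OF f] det_transpose[of _ "card S"])
qed

lemma det_on_empty [simp]: "det_on {} M = 1"
  by (simp add: det_on_def)

lemma det_on_singleton [simp]: "det_on {a} M = M a a"
  by (simp add: det_on_def sign_id)

section \<open>Block triangular matrices and row operations\<close>

text \<open>A permutation sending some element of \<open>T\<close> into \<open>S\<close> picks a
  zero entry, so only permutations preserving \<open>T\<close> contribute. These are exactly the
  products of a permutation of \<open>S\<close> and a permutation of \<open>T\<close>, and the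
  Leibniz sum factors accordingly.\<close>

lemma det_on_block_triangular:
  fixes M :: "'v \<Rightarrow> 'v \<Rightarrow> 'a::comm_ring_1"
  assumes S: "finite S" and T: "finite T" and disj: "S \<inter> T = {}"
    and zero: "\<And>A B. A \<in> T \<Longrightarrow> B \<in> S \<Longrightarrow> M A B = 0"
  shows "det_on (S \<union> T) M = det_on S M * det_on T M"
proof -
  let ?t = "\<lambda>R p. of_int (sign p) * (\<Prod>i\<in>R. M i (p i)) :: 'a"
  let ?P = "{p. p permutes S \<union> T \<and> p ` T \<subseteq> T}"
  have ST: "finite (S \<union> T)" using S T by simp
  have "det_on (S \<union> T) M = (\<Sum>p\<in>?P. ?t (S \<union> T) p)"
    unfolding det_on_def
  proof (rule sum.mono_neutral_right)
    show "finite {p. p permutes S \<union> T}" using ST by (rule finite_permutations)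
    show "\<forall>p\<in>{p. p permutes S \<union> T} - ?P. ?t (S \<union> T) p = 0"
    proof
      fix p assume "p \<in> {p. p permutes S \<union> T} - ?P"
      then obtain i where p: "p permutes S \<union> T" and i: "i \<in> T" "p i \<notin> T" by auto
      then have "p i \<in> S" using permutes_in_image[OF p, of i] by auto
      then have "M i (p i) = 0" using zero i by simp
      then have "(\<Prod>i\<in>S \<union> T. M i (p i)) = 0"
        using i ST by (intro prod_zero) auto
      then show "?t (S \<union> T) p = 0" by simp
    qed
  qed auto
  \<comment> \<open>A permutation preserving \<open>T\<close> corresponds to its two restrictions,
    each extended by the identity; composition is the inverse map.\<close>
  also have "\<dots> = (\<Sum>(p, p')\<in>{p. p permutes S} \<times> {p. p permutes T}. ?t S p * ?t T p')"
  proof (rule sum.reindex_bij_witness[where i = "\<lambda>(p, p'). p \<circ> p'"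
          and j = "\<lambda>p. (restrict_id p S, restrict_id p T)"])
    fix p assume "p \<in> ?P"
    then have p: "p permutes S \<union> T" and pT: "p ` T \<subseteq> T" by auto
    have inj: "inj_on p R" for R using permutes_inj_on[OF p] .
    \<comment> \<open>Injectivity and finiteness of \<open>T\<close> make \<open>p\<close> map
      \<open>T\<close> onto itself. Hence \<open>p\<close> also preserves the complement of
      \<open>T\<close>, which is \<open>S\<close>.\<close>
    have bT: "bij_betw p T T"
      using pT inj T by (metis bij_betw_def endo_inj_surj)
    have "bij_betw p ((S \<union> T) - T) ((S \<union> T) - T)"
      using bij_betw_DiffI[OF permutes_imp_bij[OF p] bT] by simp
    then have bS: "bij_betw p S S" using disj by (simp add: Un_Diff Diff_triv)
    have pS: "restrict_id p S permutes S" and pT': "restrict_id p T permutes T"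
      using bS bT by (auto intro!: permutes_restrict_id)
    then show "(restrict_id p S, restrict_id p T) \<in> {p. p permutes S} \<times> {p. p permutes T}" by simp
    have comp: "restrict_id p S \<circ> restrict_id p T = p"
    proof
      fix x
      show "(restrict_id p S \<circ> restrict_id p T) x = p x"
        using disj pT permutes_not_in[OF p, of x]
        by (auto simp: restrict_id_def)
    qed
    then show "(\<lambda>(p, p'). p \<circ> p') (restrict_id p S, restrict_id p T) = p" by simp
    have "sign p = sign (restrict_id p S) * sign (restrict_id p T)"
      using sign_compose[of "restrict_id p S" "restrict_id p T"] pS pT' S T
      by (metis comp permutation_permutes)
    moreover have "(\<Prod>i\<in>S \<union> T. M i (p i)) =
        (\<Prod>i\<in>S. M i (restrict_id p S i)) * (\<Prod>i\<in>T. M i (restrict_id p T i))"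
      using S T disj by (simp add: prod.union_disjoint)
    ultimately show "(case (restrict_id p S, restrict_id p T) of
        (p, p') \<Rightarrow> ?t S p * ?t T p') = ?t (S \<union> T) p"
      by (simp add: algebra_simps)
  next
    fix pp assume "pp \<in> {p. p permutes S} \<times> {p. p permutes T}"
    then obtain p p' where pp: "pp = (p, p')" and p: "p permutes S" and p': "p' permutes T" by auto
    have "p \<circ> p' permutes S \<union> T"
      using permutes_subset[OF p, of "S \<union> T"] permutes_subset[OF p', of "S \<union> T"]
      by (auto intro: permutes_compose)
    moreover have eqT: "(p \<circ> p') x = p' x" if "x \<in> T" for x
      using that disj permutes_in_image[OF p', of x] permutes_not_in[OF p, of "p' x"] by auto
    moreover have eqS: "(p \<circ> p') x = p x" if "x \<in> S" for x
      using that disj permutes_not_in[OF p', of x] by (metis comp_apply disjoint_iff)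
    ultimately show "(\<lambda>(p, p'). p \<circ> p') pp \<in> ?P"
      using pp permutes_in_image[OF p'] by auto
    have "restrict_id (p \<circ> p') S = p" "restrict_id (p \<circ> p') T = p'"
      using eqS eqT permutes_not_in[OF p] permutes_not_in[OF p']
      by (auto simp: restrict_id_def fun_eq_iff)
    then show "(restrict_id ((\<lambda>(p, p'). p \<circ> p') pp) S, restrict_id ((\<lambda>(p, p'). p \<circ> p') pp) T) = pp"
      by (simp add: pp)
  qed
  also have "\<dots> = det_on S M * det_on T M"
    unfolding det_on_def by (simp add: sum_product sum.cartesian_product)
  finally show ?thesis .
qed

lemma det_on_block_diagonal:
  fixes M :: "'v \<Rightarrow> 'v \<Rightarrow> 'a::comm_ring_1"
  assumes "finite I" and "\<And>i. i \<in> I \<Longrightarrow> finite (T i)"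
    and "\<And>i j A. i \<in> I \<Longrightarrow> j \<in> I \<Longrightarrow> A \<in> T i \<Longrightarrow> A \<in> T j \<Longrightarrow> i = j"
    and "\<And>i j A B. i \<in> I \<Longrightarrow> j \<in> I \<Longrightarrow> i \<noteq> j \<Longrightarrow> A \<in> T i \<Longrightarrow> B \<in> T j \<Longrightarrow> M A B = 0"
  shows "det_on (\<Union>i\<in>I. T i) M = (\<Prod>i\<in>I. det_on (T i) M)"
  using assms
proof (induction I rule: finite_induct)
  case (insert i I)
  have "det_on (T i \<union> (\<Union>j\<in>I. T j)) M = det_on (T i) M * det_on (\<Union>j\<in>I. T j) M"
  proof (rule det_on_block_triangular)
    show "T i \<inter> (\<Union>j\<in>I. T j) = {}"
      using insert.hyps insert.prems(2)[of i] by fastforce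
    show "M A B = 0" if "A \<in> (\<Union>j\<in>I. T j)" "B \<in> T i" for A B
      using that insert.hyps insert.prems(3)[of _ i A B] by auto
  qed (use insert in auto)
  also have "det_on (\<Union>j\<in>I. T j) M = (\<Prod>j\<in>I. det_on (T j) M)"
    using insert.prems by (intro insert.IH) (blast+)
  finally show ?case using insert.hyps by simp
qed simp

lemma det_on_diagonal:
  fixes c :: "'v \<Rightarrow> 'a::comm_ring_1"
  assumes "finite S"
  shows "det_on S (\<lambda>A B. if A = B then c A else 0) = (\<Prod>A\<in>S. c A)"
  using det_on_block_diagonal[of S "\<lambda>A. {A}" "\<lambda>A B. if A = B then c A else 0"] assms by simp

text \<open>Adding to the rows in \<open>T\<close> multiples of the rows outside \<open>T\<close> is
  multiplication from the left by a block unitriangular matrix, which has determinant 1.\<close>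

lemma det_on_row_operations:
  fixes M :: "'v \<Rightarrow> 'v \<Rightarrow> 'a::comm_ring_1"
  assumes S: "finite S" and T: "T \<subseteq> S"
  shows "det_on S (\<lambda>A B. if A \<in> T then M A B + (\<Sum>C\<in>S - T. l A C * M C B) else M A B) =
    det_on S M"
proof -
  \<comment> \<open>The identity plus the coefficients \<open>l\<close> in rows of \<open>T\<close>
    and columns outside \<open>T\<close>; both diagonal blocks are identity matrices.\<close>
  let ?L = "\<lambda>A B. if A = B then 1 else if A \<in> T \<and> B \<notin> T then l A B else 0"
  have "(if A \<in> T then M A B + (\<Sum>C\<in>S - T. l A C * M C B) else M A B) =
      (\<Sum>C\<in>S. ?L A C * M C B)" if A: "A \<in> S" for A B
  proof -
    have "(\<Sum>C\<in>S. ?L A C * M C B) = M A B + (\<Sum>C\<in>S - {A}. ?L A C * M C B)"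
      using S A by (simp add: sum.remove)
    also have "(\<Sum>C\<in>S - {A}. ?L A C * M C B) = (if A \<in> T then \<Sum>C\<in>S - T. l A C * M C B else 0)"
    proof (cases "A \<in> T")
      case True
      then have "(\<Sum>C\<in>S - {A}. ?L A C * M C B) = (\<Sum>C\<in>S - T. ?L A C * M C B)"
        using S by (intro sum.mono_neutral_right) auto
      also have "\<dots> = (\<Sum>C\<in>S - T. l A C * M C B)"
        using True by (intro sum.cong) auto
      finally show ?thesis using True by simp
    qed (simp add: sum.neutral)
    finally show ?thesis by simp
  qed
  then have "det_on S (\<lambda>A B. if A \<in> T then M A B + (\<Sum>C\<in>S - T. l A C * M C B) else M A B) =
      det_on S (\<lambda>A B. \<Sum>C\<in>S. ?L A C * M C B)"
    by (intro det_on_cong)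
  also have "\<dots> = det_on S ?L * det_on S M"
    using S by (rule det_on_mult)
  also have "det_on S ?L = 1"
  proof -
    have "det_on (T \<union> (S - T)) ?L = det_on T ?L * det_on (S - T) ?L"
      using S T by (intro det_on_block_triangular) (auto dest: finite_subset)
    moreover have "det_on T ?L = det_on T (\<lambda>A B. if A = B then 1 else 0)"
      by (intro det_on_cong) auto
    moreover have "det_on (S - T) ?L = det_on (S - T) (\<lambda>A B. if A = B then 1 else 0)"
      by (intro det_on_cong) auto
    moreover have "T \<union> (S - T) = S" using T by auto
    moreover have "finite T" "finite (S - T)" using S T by (auto dest: finite_subset)
    ultimately show ?thesis using det_on_diagonal[of _ "\<lambda>_::'v. 1::'a"] by simp
  qed
  finally show ?thesis by simp
qed

section \<open>The determinant of a matrix with one corridor\<close>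

text \<open>Fix \<open>a\<close> in \<open>S\<close>. Subtracting row \<open>a\<close> from all
  other rows and then adding all other columns to column \<open>a\<close> leaves a triangular matrix
  with diagonal entries \<open>1 + (card S - 1) * q\<close> once and \<open>1 - q\<close>
  otherwise.\<close>

lemma det_on_constant_off_diagonal:
  fixes q :: "'a::comm_ring_1"
  assumes S: "finite S" "S \<noteq> {}"
  shows "det_on S (\<lambda>A B. if A = B then 1 else q) =
    (1 + of_nat (card S - 1) * q) * (1 - q) ^ (card S - 1)"
proof -
  obtain a where a: "a \<in> S" using S by auto
  let ?M = "\<lambda>A B. if A = B then 1 else q"
  \<comment> \<open>The matrix after row \<open>a\<close> has been subtracted from every other
    row.\<close>
  let ?N = "\<lambda>A B. if A = a then ?M A B else if B = a then q - 1 else if A = B then 1 - q else 0"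
  \<comment> \<open>The matrix after the remaining columns of \<open>?N\<close> have been added to
    column \<open>a\<close>: below the corner the sum is
    \<open>(q - 1) + (1 - q) = 0\<close>.\<close>
  let ?T = "\<lambda>A B. if A = a \<and> B = a then 1 + of_nat (card S - 1) * q
     else if A = a then q else if A = B then 1 - q else 0"
  have Sa: "S - (S - {a}) = {a}" using a by auto
  have "det_on S ?M =
      det_on S (\<lambda>A B. if A \<in> S - {a} then ?M A B + (\<Sum>C\<in>S - (S - {a}). -1 * ?M C B) else ?M A B)"
    using S by (intro det_on_row_operations[symmetric]) auto
  also have "\<dots> = det_on S ?N"
    unfolding Sa by (intro det_on_cong) auto
  \<comment> \<open>The column operation is carried out as a row operation on the transpose.\<close>
  also have "\<dots> = det_on S (\<lambda>A B. ?N B A)"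
    using S(1) by (rule det_on_transpose[symmetric])
  also have "\<dots> = det_on S
      (\<lambda>A B. if A \<in> {a} then ?N B A + (\<Sum>C\<in>S - {a}. 1 * ?N B C) else ?N B A)"
    using S(1) a by (intro det_on_row_operations[symmetric]) auto
  also have "\<dots> = det_on S (\<lambda>A B. ?T B A)"
  proof (rule det_on_cong)
    fix A B assume AB: "A \<in> S" "B \<in> S"
    have "(\<Sum>C\<in>S - {a}. if a = C then 1 else q) = (\<Sum>C\<in>S - {a}. q)"
      by (intro sum.cong) auto
    also have "\<dots> = of_nat (card S - Suc 0) * q" using S a by simp
    finally have "(\<Sum>C\<in>S - {a}. if a = C then 1 else q) = of_nat (card S - Suc 0) * q" .
    then show "(if A \<in> {a} then ?N B A + (\<Sum>C\<in>S - {a}. 1 * ?N B C) else ?N B A) = ?T B A"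
      using S AB by simp
  qed
  also have "\<dots> = det_on S ?T"
    using S(1) by (rule det_on_transpose)
  also have "\<dots> = det_on {a} ?T * det_on (S - {a}) ?T"
    using det_on_block_triangular[of "{a}" "S - {a}" ?T] S a by (simp add: insert_absorb)
  also have "det_on (S - {a}) ?T = det_on (S - {a}) (\<lambda>A B. if A = B then 1 - q else 0)"
    by (intro det_on_cong) auto
  also have "\<dots> = (1 - q) ^ (card S - 1)"
    using S a det_on_diagonal[of "S - {a}" "\<lambda>_. 1 - q"] by simp
  finally show ?thesis by simp
qed

text \<open>Subtracting \<open>M A (w A)\<close> times row \<open>w A\<close> from row
  \<open>A\<close>, for each \<open>A\<close> outside \<open>U\<close>, clears the columns of
  \<open>U\<close> in these rows by \<open>fac\<close>. The result is block triangular, with a Schur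
  complement as its second block.\<close>

lemma det_on_retract_eliminate:
  fixes M :: "'v \<Rightarrow> 'v \<Rightarrow> 'a::comm_ring_1"
  assumes K: "finite K" and U: "U \<subseteq> K"
    and w: "\<And>A. A \<in> K \<Longrightarrow> w A \<in> U"
    and fac: "\<And>A c. A \<in> K - U \<Longrightarrow> c \<in> U \<Longrightarrow> M A c = M A (w A) * M (w A) c"
  shows "det_on K M = det_on U M * det_on (K - U) (\<lambda>A B. M A B - M A (w A) * M (w A) B)"
proof -
  let ?l = "\<lambda>A C. if C = w A then - M A (w A) else 0"
  let ?N = "\<lambda>A B. if A \<in> K - U then M A B - M A (w A) * M (w A) B else M A B"
  have "det_on K M = det_on K
      (\<lambda>A B. if A \<in> K - U then M A B + (\<Sum>C\<in>K - (K - U). ?l A C * M C B) else M A B)"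
    using K by (intro det_on_row_operations[symmetric]) auto
  also have "\<dots> = det_on K ?N"
  proof (rule det_on_cong)
    fix A B assume A: "A \<in> K"
    have fin: "finite U" using K U by (rule finite_subset[rotated])
    have "(\<Sum>C\<in>U. ?l A C * M C B) = (\<Sum>C\<in>U. if C = w A then - M A (w A) * M C B else 0)"
      by (intro sum.cong) auto
    also have "\<dots> = - M A (w A) * M (w A) B"
      using fin w[OF A] by simp
    finally have "(\<Sum>C\<in>K - (K - U). ?l A C * M C B) = - M A (w A) * M (w A) B"
      using U by (simp only: double_diff[OF U order.refl])
    then show "(if A \<in> K - U then M A B + (\<Sum>C\<in>K - (K - U). ?l A C * M C B) else M A B) = ?N A B"
      by (simp only: mult_minus_left add_uminus_conv_diff)
  qed
  also have "\<dots> = det_on (U \<union> (K - U)) ?N"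
    using U by (simp add: Un_absorb1)
  also have "\<dots> = det_on U ?N * det_on (K - U) ?N"
  proof (rule det_on_block_triangular)
    show "?N A B = 0" if "A \<in> K - U" "B \<in> U" for A B
      using that fac[of A B] by simp
  qed (use K U in \<open>auto dest: finite_subset\<close>)
  also have "det_on U ?N = det_on U M"
    by (intro det_on_cong) auto
  also have "det_on (K - U) ?N = det_on (K - U) (\<lambda>A B. M A B - M A (w A) * M (w A) B)"
    by (intro det_on_cong) auto
  finally show ?thesis .
qed

text \<open>Elimination is used twice. Applied to \<open>U\<close> inside \<open>K\<close>, it
  splits off the block on \<open>U\<close> and leaves a matrix that is block diagonal over the
  fibres of \<open>w\<close> without their base points. Applied backwards to \<open>{c}\<close>
  inside the fibre over \<open>c\<close>, it identifies the block there with the determinant of the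
  whole fibre.\<close>

lemma det_on_corridor:
  fixes M :: "'v \<Rightarrow> 'v \<Rightarrow> 'a::comm_ring_1"
  assumes K: "finite K" and U: "U \<subseteq> K" "U \<noteq> {}"
    and w: "\<And>A. A \<in> K \<Longrightarrow> w A \<in> U" and wU: "\<And>c. c \<in> U \<Longrightarrow> w c = c"
    and one: "\<And>A. A \<in> K \<Longrightarrow> M A A = 1"
    and fac: "\<And>A B. A \<in> K \<Longrightarrow> B \<in> K \<Longrightarrow> w A \<noteq> w B \<Longrightarrow> M A B = M A (w A) * q * M (w B) B"
  shows "det_on K M = (1 + of_nat (card U - 1) * q) * (1 - q) ^ (card U - 1) *
    (\<Prod>c\<in>U. det_on {A \<in> K. w A = c} M)"
proof -
  let ?N = "\<lambda>A B. M A B - M A (w A) * M (w A) B"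
  let ?T = "\<lambda>c. {A \<in> K. w A = c} - {c}"
  have UK: "c \<in> K" if "c \<in> U" for c using U that by auto
  have UU: "M c c' = q" if "c \<in> U" "c' \<in> U" "c \<noteq> c'" for c c'
    using that fac[OF UK UK] one UK by (simp add: wU)
  have finU: "finite U" using K U by (auto dest: finite_subset)
  have "det_on K M = det_on U M * det_on (K - U) ?N"
  proof (rule det_on_retract_eliminate[OF K U(1) w])
    fix A c assume A: "A \<in> K - U" and c: "c \<in> U"
    show "M A c = M A (w A) * M (w A) c"
    proof (cases "w A = c")
      case True
      then show ?thesis using one UK c by simp
    next
      case False
      then have "M A c = M A (w A) * q * M c c"
        using fac[of A c] A c UK by (simp add: wU)
      moreover have "M (w A) c = q" using UU False A c w by auto
      ultimately show ?thesis using one UK c by simp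
    qed
  qed
  also have "det_on U M = det_on U (\<lambda>A B. if A = B then 1 else q)"
    by (intro det_on_cong) (auto simp: UU one UK)
  also have "\<dots> = (1 + of_nat (card U - 1) * q) * (1 - q) ^ (card U - 1)"
    using finU U(2) by (rule det_on_constant_off_diagonal)
  also have "K - U = (\<Union>c\<in>U. ?T c)"
    using w wU by (auto, metis)
  also have "det_on \<dots> ?N = (\<Prod>c\<in>U. det_on (?T c) ?N)"
  proof (rule det_on_block_diagonal)
    fix c c' A B assume c: "c \<in> U" "c' \<in> U" "c \<noteq> c'" and A: "A \<in> ?T c" and B: "B \<in> ?T c'"
    \<comment> \<open>Both factorisations end in the factor \<open>q * M c' B\<close>, so
      \<open>M A B = M A c * M c B\<close> and entries between different fibres cancel.\<close>
    then have "M A B = M A c * q * M c' B" "M c B = q * M c' B"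
      using fac[of A B] fac[of c B] one UK by (auto simp: wU)
    then show "?N A B = 0" using A by (simp add: mult.assoc)
  qed (use K finU in auto)
  also have "\<dots> = (\<Prod>c\<in>U. det_on {A \<in> K. w A = c} M)"
  proof (rule prod.cong)
    fix c assume c: "c \<in> U"
    \<comment> \<open>On this fibre \<open>w\<close> is constantly \<open>c\<close>, so the
      factorisation required for elimination along \<open>{c}\<close> reduces to
      \<open>M c c = 1\<close>.\<close>
    have "det_on {A \<in> K. w A = c} M = det_on {c} M * det_on (?T c) ?N"
      using K c wU UK one by (intro det_on_retract_eliminate) auto
    then show "det_on (?T c) ?N = det_on {A \<in> K. w A = c} M"
      using one UK c by simp
  qed simp
  finally show ?thesis .
qed

section \<open>Joint fibres of several retractions\<close>

text \<open>The class of \<open>A\<close> in the common refinement of the partitions of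
  \<open>V\<close> given by the maps \<open>w i\<close>. For empty \<open>I\<close> there is one
  class, \<open>V\<close> itself.\<close>

definition fibre :: "'v set \<Rightarrow> ('i \<Rightarrow> 'v \<Rightarrow> 'v) \<Rightarrow> 'i set \<Rightarrow> 'v \<Rightarrow> 'v set" where
  "fibre V w I A = {B \<in> V. \<forall>i\<in>I. w i B = w i A}"

lemma fibre_self: "A \<in> V \<Longrightarrow> A \<in> fibre V w I A"
  by (simp add: fibre_def)

lemma fibre_eqI:
  assumes "B \<in> fibre V w I A"
  shows "fibre V w I B = fibre V w I A"
proof -
  have "w i B = w i A" if "i \<in> I" for i using assms that by (simp add: fibre_def)
  then show ?thesis unfolding fibre_def by simp
qed

text \<open>By \<open>const\<close>, the set \<open>U i\<close> lies in one joint fibre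
  \<open>K\<close>, and \<open>w i\<close> cuts \<open>K\<close> into one nonempty piece for each
  element of \<open>U i\<close>. By \<open>sep\<close>, the map \<open>w i\<close> is constant on
  every other joint fibre, so these stay whole.\<close>

lemma fibres_insert:
  assumes U: "\<And>j. j \<in> insert i I \<Longrightarrow> U j \<noteq> {}" "U i \<subseteq> V"
    and w: "\<And>A. A \<in> V \<Longrightarrow> w i A \<in> U i" and wU: "\<And>c. c \<in> U i \<Longrightarrow> w i c = c"
    and const: "\<And>j c c'. j \<in> I \<Longrightarrow> c \<in> U i \<Longrightarrow> c' \<in> U i \<Longrightarrow> w j c = w j c'"
    and sep: "\<And>j A a c. j \<in> I \<Longrightarrow> A \<in> V \<Longrightarrow> a \<in> U j \<Longrightarrow> c \<in> U i \<Longrightarrow>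
      w j A \<noteq> w j c \<Longrightarrow> w i A = w i a"
  obtains K where "K \<in> fibre V w I ` V" "U i \<subseteq> K"
    and "fibre V w (insert i I) ` V =
      (fibre V w I ` V - {K}) \<union> (\<lambda>c. {B \<in> K. w i B = c}) ` U i"
    and "(fibre V w I ` V - {K}) \<inter> (\<lambda>c. {B \<in> K. w i B = c}) ` U i = {}"
    and "inj_on (\<lambda>c. {B \<in> K. w i B = c}) (U i)"
proof -
  obtain c0 where c0: "c0 \<in> U i" using U(1)[of i] by blast
  define K where "K = fibre V w I c0"
  let ?F = "fibre V w I" and ?G = "fibre V w (insert i I)"
  have UK: "U i \<subseteq> K" using const[OF _ _ c0] U(2) by (auto simp: K_def fibre_def)
  have inK: "?G A = {B \<in> K. w i B = w i A}" if "A \<in> K" for A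
    using that by (auto simp: K_def fibre_def)
  \<comment> \<open>Some \<open>j\<close> in \<open>I\<close> separates \<open>A\<close>, and with
    it its whole joint fibre, from \<open>U i\<close>. Then \<open>sep\<close> forces
    \<open>w i\<close> to take the value \<open>w i a\<close> on all of this fibre.\<close>
  have outK: "?G A = ?F A" if A: "A \<in> V" "A \<notin> K" for A
  proof -
    obtain j where j: "j \<in> I" "w j A \<noteq> w j c0" using A by (auto simp: K_def fibre_def)
    obtain a where a: "a \<in> U j" using U(1)[of j] j by blast
    have "w i B = w i A" if "B \<in> ?F A" for B
      using sep[OF j(1) A(1) a c0 j(2)] sep[OF j(1) _ a c0, of B] that j by (auto simp: fibre_def)
    then show ?thesis by (auto simp: fibre_def)
  qed
  have KF: "?F A = K" if "A \<in> K" for A using that unfolding K_def by (rule fibre_eqI)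
  show thesis
  proof
    show "K \<in> ?F ` V" using c0 U(2) by (auto simp: K_def)
    show "U i \<subseteq> K" by (rule UK)
    show "?G ` V = (?F ` V - {K}) \<union> (\<lambda>c. {B \<in> K. w i B = c}) ` U i"
    proof (rule subset_antisym; rule subsetI)
      fix X assume "X \<in> ?G ` V"
      then obtain A where A: "A \<in> V" "X = ?G A" by auto
      show "X \<in> (?F ` V - {K}) \<union> (\<lambda>c. {B \<in> K. w i B = c}) ` U i"
      proof (cases "A \<in> K")
        case True
        then show ?thesis using A inK w by auto
      next
        case False
        then show ?thesis using A outK fibre_self by fastforce
      qed
    next
      fix X assume "X \<in> (?F ` V - {K}) \<union> (\<lambda>c. {B \<in> K. w i B = c}) ` U i"
      then show "X \<in> ?G ` V"
      proof
        assume "X \<in> ?F ` V - {K}"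
        then obtain A where A: "A \<in> V" "X = ?F A" "A \<notin> K" using KF by auto
        then show ?thesis using outK by auto
      next
        assume "X \<in> (\<lambda>c. {B \<in> K. w i B = c}) ` U i"
        then obtain c where c: "c \<in> U i" "X = {B \<in> K. w i B = c}" by auto
        then have "X = ?G c" using inK wU UK by auto
        then show ?thesis using c U(2) by auto
      qed
    qed
    show "(?F ` V - {K}) \<inter> (\<lambda>c. {B \<in> K. w i B = c}) ` U i = {}"
    proof (rule ccontr)
      assume "\<not> ?thesis"
      \<comment> \<open>Each new piece contains its base point \<open>c\<close>, which lies in
        \<open>K\<close>; a joint fibre containing \<open>c\<close> can only be
        \<open>K\<close>.\<close>
      then obtain A c where A: "?F A \<noteq> K" "?F A = {B \<in> K. w i B = c}" and c: "c \<in> U i" by auto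
      then have "c \<in> K" "c \<in> ?F A" using UK wU by auto
      then show False using A KF fibre_eqI by metis
    qed
    show "inj_on (\<lambda>c. {B \<in> K. w i B = c}) (U i)"
    proof (rule inj_onI)
      fix c c' assume c: "c \<in> U i" and eq: "{B \<in> K. w i B = c} = {B \<in> K. w i B = c'}"
      have "c \<in> {B \<in> K. w i B = c}" using c UK wU[OF c] by auto
      then show "c = c'" unfolding eq using wU[OF c] by simp
    qed
  qed
qed

text \<open>The retractions are imposed one after the other. Each new one refines a single joint
  fibre \<open>K\<close>, where \<open>det_on_corridor\<close> replaces \<open>det_on K M\<close> by
  the factor of the corridor times the determinants of the \<open>card (U i)\<close> pieces.\<close>

lemma det_on_fibres:
  fixes M :: "'v \<Rightarrow> 'v \<Rightarrow> 'a::comm_ring_1"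
  assumes V: "finite V" "V \<noteq> {}" and "finite I"
    and U: "\<And>i. i \<in> I \<Longrightarrow> U i \<noteq> {}" "\<And>i. i \<in> I \<Longrightarrow> U i \<subseteq> V"
    and w: "\<And>i A. i \<in> I \<Longrightarrow> A \<in> V \<Longrightarrow> w i A \<in> U i"
    and wU: "\<And>i c. i \<in> I \<Longrightarrow> c \<in> U i \<Longrightarrow> w i c = c"
    and const: "\<And>i j c c'. i \<in> I \<Longrightarrow> j \<in> I \<Longrightarrow> i \<noteq> j \<Longrightarrow> c \<in> U i \<Longrightarrow> c' \<in> U i \<Longrightarrow> w j c = w j c'"
    and sep: "\<And>i j A a c. i \<in> I \<Longrightarrow> j \<in> I \<Longrightarrow> i \<noteq> j \<Longrightarrow> A \<in> V \<Longrightarrow> a \<in> U j \<Longrightarrow> c \<in> U i \<Longrightarrow>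
      w j A \<noteq> w j c \<Longrightarrow> w i A = w i a"
    and one: "\<And>A. A \<in> V \<Longrightarrow> M A A = 1"
    and fac: "\<And>i A B. i \<in> I \<Longrightarrow> A \<in> V \<Longrightarrow> B \<in> V \<Longrightarrow> w i A \<noteq> w i B \<Longrightarrow>
      M A B = M A (w i A) * q i * M (w i B) B"
  shows "det_on V M =
      (\<Prod>i\<in>I. (1 + of_nat (card (U i) - 1) * q i) * (1 - q i) ^ (card (U i) - 1)) *
      (\<Prod>K\<in>fibre V w I ` V. det_on K M)"
    and "card (fibre V w I ` V) = Suc (\<Sum>i\<in>I. card (U i) - 1)"
proof -
  let ?f = "\<lambda>i. (1 + of_nat (card (U i) - 1) * q i) * (1 - q i) ^ (card (U i) - 1)"
  \<comment> \<open>Both claims are proved together because they rest on the same splitting, and for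
    all \<open>J \<subseteq> I\<close> so that the hypotheses about \<open>I\<close> stay fixed
    during the induction.\<close>
  have "det_on V M = (\<Prod>i\<in>J. ?f i) * (\<Prod>K\<in>fibre V w J ` V. det_on K M) \<and>
      card (fibre V w J ` V) = Suc (\<Sum>i\<in>J. card (U i) - 1)" if "J \<subseteq> I" for J
    using finite_subset[OF that \<open>finite I\<close>] that
  proof (induction J rule: finite_induct)
    case empty
    have "fibre V w {} ` V = {V}" using V by (auto simp: fibre_def)
    then show ?case by simp
  next
    case (insert i J)
    have iJ: "i \<in> I" "\<And>j. j \<in> J \<Longrightarrow> j \<in> I" "\<And>j. j \<in> J \<Longrightarrow> i \<noteq> j"
      using insert by auto
    let ?p = "\<lambda>K c. {B \<in> K. w i B = c}"
    obtain K where K: "K \<in> fibre V w J ` V" "U i \<subseteq> K"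
      and split: "fibre V w (insert i J) ` V = (fibre V w J ` V - {K}) \<union> ?p K ` U i"
      and disj: "(fibre V w J ` V - {K}) \<inter> ?p K ` U i = {}"
      and inj: "inj_on (?p K) (U i)"
    proof (rule fibres_insert[where U = U and w = w and i = i and I = J and V = V])
      show "w i A = w i a" if "j \<in> J" "A \<in> V" "a \<in> U j" "c \<in> U i" "w j A \<noteq> w j c" for j A a c
        by (rule sep[OF iJ(1) iJ(2)[OF that(1)] iJ(3)[OF that(1)] that(2-5)])
      show "U j \<noteq> {}" if "j \<in> insert i J" for j using that iJ U(1) by blast
      show "U i \<subseteq> V" by (rule U(2)[OF iJ(1)])
      show "w i A \<in> U i" if "A \<in> V" for A by (rule w[OF iJ(1) that])
      show "w i c = c" if "c \<in> U i" for c by (rule wU[OF iJ(1) that])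
      show "w j c = w j c'" if "j \<in> J" "c \<in> U i" "c' \<in> U i" for j c c'
        by (rule const[OF iJ(1) iJ(2)[OF that(1)] iJ(3)[OF that(1)] that(2,3)])
    qed (rule that)
    have KV: "K \<subseteq> V" using K(1) by (auto simp: fibre_def)
    have finQ: "finite (fibre V w J ` V)" using V by simp
    have finU: "finite (U i)" using U(2)[OF iJ(1)] V(1) by (rule finite_subset)
    have detK: "det_on K M = ?f i * (\<Prod>c\<in>U i. det_on (?p K c) M)"
    proof (rule det_on_corridor)
      show "finite K" using KV V(1) by (rule finite_subset)
      show "U i \<subseteq> K" by (rule K(2))
      show "U i \<noteq> {}" by (rule U(1)[OF iJ(1)])
      show "w i A \<in> U i" if "A \<in> K" for A using w[OF iJ(1)] that KV by blast
      show "w i c = c" if "c \<in> U i" for c by (rule wU[OF iJ(1) that])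
      show "M A A = 1" if "A \<in> K" for A using one that KV by blast
      show "M A B = M A (w i A) * q i * M (w i B) B"
        if "A \<in> K" "B \<in> K" "w i A \<noteq> w i B" for A B
        using fac[OF iJ(1)] that KV by blast
    qed
    have IH: "det_on V M = prod ?f J * (\<Prod>K\<in>fibre V w J ` V. det_on K M)"
      "card (fibre V w J ` V) = Suc (\<Sum>i\<in>J. card (U i) - 1)"
      using insert by auto
    have "(\<Prod>K\<in>fibre V w J ` V. det_on K M) =
        det_on K M * (\<Prod>K\<in>fibre V w J ` V - {K}. det_on K M)"
      using K(1) finQ by (rule prod.remove[rotated])
    also have "\<dots> = ?f i * ((\<Prod>K\<in>fibre V w J ` V - {K}. det_on K M) * (\<Prod>X\<in>?p K ` U i. det_on X M))"
      unfolding detK by (simp add: prod.reindex[OF inj] o_def mult_ac)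
    also have "(\<Prod>K\<in>fibre V w J ` V - {K}. det_on K M) * (\<Prod>X\<in>?p K ` U i. det_on X M) =
        (\<Prod>K\<in>fibre V w (insert i J) ` V. det_on K M)"
      unfolding split using finQ finU disj by (intro prod.union_disjoint[symmetric]) auto
    finally have "det_on V M = prod ?f (insert i J) * (\<Prod>K\<in>fibre V w (insert i J) ` V. det_on K M)"
      unfolding IH(1) using insert.hyps by (simp add: mult_ac)
    \<comment> \<open>One fibre disappears and \<open>card (U i)\<close> pieces appear. As
      \<open>card (U i)\<close> is positive, the increase is exactly the natural number
      \<open>card (U i) - 1\<close>.\<close>
    moreover have "card (fibre V w (insert i J) ` V) = card (fibre V w J ` V - {K}) + card (U i)"
      unfolding split using finQ finU disj
      by (subst card_Un_disjoint) (auto simp: card_image[OF inj])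
    moreover have "card (U i) > 0" using U(1)[OF iJ(1)] finU by (simp add: card_gt_0_iff)
    ultimately show ?case using IH(2) K(1) finQ insert.hyps by simp
  qed
  from this[of I] show "det_on V M = (\<Prod>i\<in>I. ?f i) * (\<Prod>K\<in>fibre V w I ` V. det_on K M)"
    "card (fibre V w I ` V) = Suc (\<Sum>i\<in>I. card (U i) - 1)" by auto
qed

text \<open>By \<open>refine\<close>, each part lies in one joint fibre, and every fibre is reached
  because the parts cover \<open>V\<close>. With equally many parts and fibres this assignment is
  injective, so a fibre cannot contain two parts and must equal its only one.\<close>

lemma indexed_partition_eq_fibres:
  assumes part: "indexed_partition V s P"
    and card: "card (fibre V w I ` V) = s"
    and refine: "\<And>l i A B. l \<in> {1..s} \<Longrightarrow> i \<in> I \<Longrightarrow> A \<in> P l \<Longrightarrow> B \<in> P l \<Longrightarrow> w i A = w i B"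
  shows "bij_betw P {1..s} (fibre V w I ` V)"
proof -
  have ne: "\<forall>l\<in>{1..s}. \<exists>a. a \<in> P l" and cover: "(\<Union>l\<in>{1..s}. P l) = V"
    using part by (auto simp: indexed_partition_def)
  obtain a where a: "\<And>l. l \<in> {1..s} \<Longrightarrow> a l \<in> P l" using bchoice[OF ne] by blast
  let ?F = "\<lambda>l. fibre V w I (a l)"
  have PF: "fibre V w I A = ?F l" if "l \<in> {1..s}" "A \<in> P l" for l A
    using refine[OF that(1) _ that(2) a[OF that(1)]] by (auto simp: fibre_def)
  have aV: "a l \<in> V" if "l \<in> {1..s}" for l
    using a[OF that] that cover by blast
  have img: "?F ` {1..s} = fibre V w I ` V"
  proof
    show "fibre V w I ` V \<subseteq> ?F ` {1..s}"
    proof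
      fix X assume "X \<in> fibre V w I ` V"
      then obtain A where A: "A \<in> V" "X = fibre V w I A" by auto
      then obtain l where "l \<in> {1..s}" "A \<in> P l" using cover by blast
      then show "X \<in> ?F ` {1..s}" using A PF by blast
    qed
  qed (use aV in auto)
  \<comment> \<open>The image of the \<open>s\<close> indices has \<open>s\<close> elements.\<close>
  have inj: "inj_on ?F {1..s}"
  proof (rule eq_card_imp_inj_on)
    show "card (?F ` {1..s}) = card {1..s}" unfolding img card by simp
  qed simp
  have "P l = ?F l" if l: "l \<in> {1..s}" for l
  proof
    show "P l \<subseteq> ?F l"
    proof
      fix A assume A: "A \<in> P l"
      then have "A \<in> V" using l cover by blast
      then show "A \<in> ?F l" using fibre_self PF[OF l A] by metis
    qed
    show "?F l \<subseteq> P l"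
    proof
      fix A assume A: "A \<in> ?F l"
      then have "A \<in> V" by (simp add: fibre_def)
      then obtain l' where l': "l' \<in> {1..s}" "A \<in> P l'" using cover by blast
      then have "?F l' = ?F l" using PF[OF l'] fibre_eqI[OF A] by simp
      then have "l' = l" using inj_onD[OF inj] l l' by blast
      then show "A \<in> P l" using l' by simp
    qed
  qed
  then have "bij_betw P {1..s} (fibre V w I ` V) \<longleftrightarrow> bij_betw ?F {1..s} (fibre V w I ` V)"
    by (rule bij_betw_cong)
  then show ?thesis using inj img by (simp add: bij_betw_def)
qed

section \<open>Minimal sequences and corridors as retractions\<close>

lemma step_values_append:
  assumes "xs \<noteq> []" "ys \<noteq> []"
  shows "step_values f (xs @ ys) = step_values f xs @ f (last xs) (hd ys) # step_values f ys"
proof -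
  have Cons: "step_values f (x # zs) = f x (hd zs) # step_values f zs" if ne: "zs \<noteq> []" for x zs
  proof -
    obtain z zs' where "zs = z # zs'" using ne by (cases zs) auto
    then show ?thesis by (simp add: step_values_def map_upt_Suc del: upt_Suc)
  qed
  show ?thesis using assms(1)
  proof (induction xs rule: list_nonempty_induct)
    case (single x)
    then show ?case using Cons[OF assms(2)] by (simp add: step_values_def)
  next
    case (cons x xs)
    then show ?case using Cons[of xs x] Cons[of "xs @ ys" x] by simp
  qed
qed

lemma min_seqs_ends:
  assumes "xs \<in> min_seqs V E A B"
  shows "xs \<noteq> []" "hd xs = A" "last xs = B"
  using assms by (auto simp: min_seqs_def seqs_def split: if_splits)

lemma min_seqs_exist:
  assumes "connected_digraph V E" "A \<in> V" "B \<in> V"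
  obtains xs where "xs \<in> min_seqs V E A B"
proof (cases "A = B")
  case False
  have "seqs V E A B \<noteq> {}" using assms by (simp add: connected_digraph_def)
  then have "\<exists>k. \<exists>xs\<in>seqs V E A B. length xs = k" by blast
  then have "\<exists>xs\<in>seqs V E A B. length xs = (LEAST k. \<exists>xs\<in>seqs V E A B. length xs = k)"
    by (rule LeastI_ex)
  then show thesis using that False by (auto simp: min_seqs_def min_len_def)
qed (use that in \<open>auto simp: min_seqs_def\<close>)

text \<open>Lengths count vertices, so the edge itself provides the competitor \<open>[A, B]\<close>
  of length 2.\<close>

lemma min_seqs_edge_length:
  assumes "xs \<in> min_seqs V E A B" "(A, B) \<in> E" "A \<in> V" "B \<in> V"
  shows "length xs \<le> 2"
proof (cases "A = B")
  case False
  have "[A, B] \<in> seqs V E A B" using assms by (simp add: seqs_def)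
  then have "(LEAST k. \<exists>xs\<in>seqs V E A B. length xs = k) \<le> 2"
    by (rule Least_le[OF bexI[rotated]]) simp
  then show ?thesis using False assms by (simp add: min_seqs_def min_len_def)
qed (use assms in \<open>simp add: min_seqs_def\<close>)

text \<open>The map \<open>w\<close> sends a vertex of \<open>W i\<close> to the vertex \<open>C i\<close>, so that the parts of the corridor
  are the fibres of a retraction onto \<open>U\<close>.\<close>

definition corridor_retraction ::
    "'v set \<Rightarrow> ('v \<times> 'v) set \<Rightarrow> 'v set \<Rightarrow> ('v \<Rightarrow> 'v) \<Rightarrow> bool" where
  "corridor_retraction V E U w \<longleftrightarrow>
     U \<subseteq> V \<and> U \<times> U \<subseteq> E \<and> (\<forall>A\<in>V. w A \<in> U) \<and> (\<forall>c\<in>U. w c = c) \<and>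
     (\<forall>A\<in>V. \<forall>B\<in>V. A \<noteq> B \<and> w A = w B \<longrightarrow>
        (\<forall>xs\<in>min_seqs V E A B. \<forall>x\<in>set xs. w x = w A)) \<and>
     (\<forall>A\<in>V. \<forall>B\<in>V. w A \<noteq> w B \<longrightarrow>
        (\<forall>xs\<in>min_seqs V E A (w A). \<forall>ys\<in>min_seqs V E (w B) B. xs @ ys \<in> min_seqs V E A B))"

lemma corridor_retractionD:
  assumes "corridor_retraction V E U w"
  shows "U \<subseteq> V" "U \<times> U \<subseteq> E"
    and "A \<in> V \<Longrightarrow> w A \<in> U" "A \<in> V \<Longrightarrow> w A \<in> V" "c \<in> U \<Longrightarrow> w c = c"
    and "A \<in> V \<Longrightarrow> B \<in> V \<Longrightarrow> A \<noteq> B \<Longrightarrow> w A = w B \<Longrightarrow> xs \<in> min_seqs V E A B \<Longrightarrow> x \<in> set xs \<Longrightarrow>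
      w x = w A"
    and "A \<in> V \<Longrightarrow> B \<in> V \<Longrightarrow> w A \<noteq> w B \<Longrightarrow> xs \<in> min_seqs V E A (w A) \<Longrightarrow>
      ys \<in> min_seqs V E (w B) B \<Longrightarrow> xs @ ys \<in> min_seqs V E A B"
proof -
  have *: "U \<subseteq> V" "U \<times> U \<subseteq> E" "\<forall>A\<in>V. w A \<in> U" "\<forall>c\<in>U. w c = c"
    "\<forall>A\<in>V. \<forall>B\<in>V. A \<noteq> B \<and> w A = w B \<longrightarrow>
        (\<forall>xs\<in>min_seqs V E A B. \<forall>x\<in>set xs. w x = w A)"
    "\<forall>A\<in>V. \<forall>B\<in>V. w A \<noteq> w B \<longrightarrow>
        (\<forall>xs\<in>min_seqs V E A (w A). \<forall>ys\<in>min_seqs V E (w B) B. xs @ ys \<in> min_seqs V E A B)"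
    using assms unfolding corridor_retraction_def by - (elim conjE, assumption)+
  show "U \<subseteq> V" "U \<times> U \<subseteq> E" by (fact *(1,2))+
  show "w A \<in> U" if "A \<in> V" using *(3) that by blast
  then show "w A \<in> V" if "A \<in> V" using *(1) that by blast
  show "w c = c" if "c \<in> U" using *(4) that by blast
  show "w x = w A" if "A \<in> V" "B \<in> V" "A \<noteq> B" "w A = w B" "xs \<in> min_seqs V E A B" "x \<in> set xs"
    using *(5) that by blast
  show "xs @ ys \<in> min_seqs V E A B" if "A \<in> V" "B \<in> V" "w A \<noteq> w B"
    "xs \<in> min_seqs V E A (w A)" "ys \<in> min_seqs V E (w B) B"
    using *(6) that by blast
qed

text \<open>With \<open>m A\<close> the index of the part containing \<open>A\<close>, the
  retraction is \<open>C (m A)\<close>. Since \<open>C\<close> is injective on indices, equality of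
  its values means lying in the same part.\<close>

lemma corridor_retraction_exists:
  assumes "connected_by_corridor V E U"
  obtains w where "corridor_retraction V E U w"
proof -
  obtain W C where UV: "U \<subseteq> V" and part: "indexed_partition V (card U) W"
    and parts: "\<forall>i\<in>{1..card U}. W i \<inter> U = {C i} \<and> min_seq_closed V E (W i)"
    and edges: "\<forall>i\<in>{1..card U}. \<forall>j\<in>{1..card U}. (C i, C j) \<in> E"
    and concats: "\<forall>i\<in>{1..card U}. \<forall>j\<in>{1..card U}. i \<noteq> j \<longrightarrow>
      (\<forall>A\<in>W i. \<forall>B\<in>W j. \<forall>xs\<in>min_seqs V E A (C i). \<forall>ys\<in>min_seqs V E (C j) B.
        xs @ ys \<in> min_seqs V E A B)"
    using assms unfolding connected_by_corridor_def by (elim conjE exE) (rule that)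
  have WC: "W i \<inter> U = {C i}" and closed: "min_seq_closed V E (W i)" if "i \<in> {1..card U}" for i
    using bspec[OF parts that] by simp_all
  have cover: "(\<Union>i\<in>{1..card U}. W i) = V" and disj: "disjoint_family_on W {1..card U}"
    using part by (auto simp: indexed_partition_def)
  have uniq: "i = j" if "A \<in> W i" "A \<in> W j" "i \<in> {1..card U}" "j \<in> {1..card U}" for i j A
    using disj that unfolding disjoint_family_on_def by blast
  have "\<forall>A\<in>V. \<exists>i\<in>{1..card U}. A \<in> W i" using cover by blast
  then obtain m where m: "\<And>A. A \<in> V \<Longrightarrow> m A \<in> {1..card U}" "\<And>A. A \<in> V \<Longrightarrow> A \<in> W (m A)"
    by metis
  have CU: "C i \<in> W i" "C i \<in> U" if "i \<in> {1..card U}" for i using WC[OF that] by auto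
  have mW: "m A = i" if "A \<in> W i" "i \<in> {1..card U}" for i A
  proof -
    have "A \<in> V" using that cover by blast
    then show ?thesis using uniq[OF m(2) that(1) m(1)] that by blast
  qed
  have Ceq: "i = j" if "C i = C j" "i \<in> {1..card U}" "j \<in> {1..card U}" for i j
    using uniq[of "C i" i j] CU(1)[OF that(2)] CU(1)[OF that(3)] that by simp
  have wU: "C (m c) = c" if "c \<in> U" for c
  proof -
    have c: "c \<in> V" using UV that by blast
    have "c \<in> W (m c) \<inter> U" using m(2)[OF c] that by simp
    then show ?thesis using WC[OF m(1)[OF c]] by simp
  qed
  show thesis
  proof (rule that[of "\<lambda>A. C (m A)"], unfold corridor_retraction_def, intro conjI ballI impI)
    show "U \<times> U \<subseteq> E"
    proof (clarify)
      fix c c' assume c: "c \<in> U" "c' \<in> U"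
      then have "c \<in> V" "c' \<in> V" using UV by auto
      then show "(c, c') \<in> E"
        using bspec[OF bspec[OF edges m(1)] m(1), of c c'] by (simp only: wU c)
    qed
  next
    fix A B xs x
    assume A: "A \<in> V" and B: "B \<in> V" and AB: "A \<noteq> B \<and> C (m A) = C (m B)"
      and xs: "xs \<in> min_seqs V E A B" "x \<in> set xs"
    have "m A = m B" using AB Ceq[OF _ m(1)[OF A] m(1)[OF B]] by simp
    then have "set xs \<subseteq> W (m A)"
      using closed[OF m(1)[OF A]] m(2)[OF A] m(2)[OF B] AB xs by (simp add: min_seq_closed_def)
    then have "m x = m A" using mW[OF _ m(1)[OF A]] xs by auto
    then show "C (m x) = C (m A)" by simp
  next
    fix A B xs ys
    assume A: "A \<in> V" and B: "B \<in> V" and neq: "C (m A) \<noteq> C (m B)"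
      and seqs: "xs \<in> min_seqs V E A (C (m A))" "ys \<in> min_seqs V E (C (m B)) B"
    have "m A \<noteq> m B" using neq by auto
    then show "xs @ ys \<in> min_seqs V E A B"
      using bspec[OF bspec[OF concats m(1)[OF A]] m(1)[OF B]] m(2)[OF A] m(2)[OF B] seqs by blast
  qed (use UV in \<open>simp_all add: CU(2)[OF m(1)] wU\<close>)
qed

section \<open>Retractions of disjoint corridors and multiplicativity\<close>

lemma min_seq_through_retraction:
  assumes G: "connected_digraph V E" and c: "corridor_retraction V E U w"
    and A: "A \<in> V" and B: "B \<in> V" and AB: "w A \<noteq> w B"
  obtains xs ys where "xs \<in> min_seqs V E A (w A)" "ys \<in> min_seqs V E (w B) B"
    "xs @ ys \<in> min_seqs V E A B" "w A \<in> set (xs @ ys)" "w B \<in> set (xs @ ys)"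
proof -
  obtain xs where xs: "xs \<in> min_seqs V E A (w A)"
    using min_seqs_exist[OF G A corridor_retractionD(4)[OF c A]] .
  obtain ys where ys: "ys \<in> min_seqs V E (w B) B"
    using min_seqs_exist[OF G corridor_retractionD(4)[OF c B] B] .
  show thesis
  proof (rule that[OF xs ys])
    show "xs @ ys \<in> min_seqs V E A B"
      by (rule corridor_retractionD(7)[OF c A B AB xs ys])
    show "w A \<in> set (xs @ ys)" "w B \<in> set (xs @ ys)"
      using last_in_set[OF min_seqs_ends(1)[OF xs]] hd_in_set[OF min_seqs_ends(1)[OF ys]]
      unfolding min_seqs_ends(3)[OF xs] min_seqs_ends(2)[OF ys] by simp_all
  qed
qed

text \<open>Two vertices of \<open>U'\<close> are joined by an edge, which leaves no room for a
  detour. If \<open>w\<close> separated them, a minimal sequence between them would run through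
  \<open>w x\<close> and \<open>w y\<close>; having at most two vertices, it would force
  \<open>x = w x\<close>, an element of \<open>U\<close>.\<close>

lemma retraction_constant_on_disjoint:
  assumes G: "connected_digraph V E"
    and c: "corridor_retraction V E U w" and c': "corridor_retraction V E U' w'"
    and disj: "U \<inter> U' = {}" and x: "x \<in> U'" "y \<in> U'"
  shows "w x = w y"
proof (rule ccontr)
  assume neq: "w x \<noteq> w y"
  have V: "x \<in> V" "y \<in> V" and edge: "(x, y) \<in> E" using corridor_retractionD(1,2)[OF c'] x by auto
  obtain xs ys where xs: "xs \<in> min_seqs V E x (w x)" and ys: "ys \<in> min_seqs V E (w y) y"
    and "xs @ ys \<in> min_seqs V E x y"
    using min_seq_through_retraction[OF G c V neq] .
  \<comment> \<open>Two vertices are shared by two nonempty lists, so \<open>xs\<close> consists of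
    \<open>x\<close> alone.\<close>
  then have "length xs + length ys \<le> 2" using min_seqs_edge_length[OF _ edge V] by fastforce
  moreover have "length ys > 0" using min_seqs_ends[OF ys] by simp
  ultimately have "length xs \<le> 1" by linarith
  then have "last xs = hd xs" using min_seqs_ends(1)[OF xs] by (cases xs) auto
  then have "w x = x" using min_seqs_ends[OF xs] by simp
  then have "x \<in> U" using corridor_retractionD(3)[OF c V(1)] by simp
  then show False using disj x by auto
qed

text \<open>Suppose \<open>w' A\<close> differs from the constant value of \<open>w'\<close> on
  \<open>U\<close>. Then some minimal sequence from \<open>A\<close> to \<open>w A\<close> passes
  through \<open>w' A\<close>. Its endpoints lie in one fibre of \<open>w\<close>, hence so does
  \<open>w' A\<close>, and \<open>w (w' A) = w A\<close>. But \<open>w\<close> is constant on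
  \<open>U'\<close>, which gives \<open>w A = w y\<close>.\<close>

lemma retraction_separation:
  assumes G: "connected_digraph V E"
    and c: "corridor_retraction V E U w" and c': "corridor_retraction V E U' w'"
    and disj: "U \<inter> U' = {}" and A: "A \<in> V" and x: "x \<in> U" and y: "y \<in> U'"
    and neq: "w A \<noteq> w y"
  shows "w' A = w' x"
proof (rule ccontr)
  assume neq': "w' A \<noteq> w' x"
  have wA: "w A \<in> U" "w A \<in> V" "w (w A) = w A" and w'A: "w' A \<in> U'"
    using corridor_retractionD(3-5)[OF c] corridor_retractionD(3)[OF c'] A by simp_all
  have "w' (w A) = w' x"
    using retraction_constant_on_disjoint[OF G c' c _ wA(1) x] disj by auto
  then have neq'': "w' A \<noteq> w' (w A)" using neq' by simp
  obtain xs ys where seq: "xs @ ys \<in> min_seqs V E A (w A)" "w' A \<in> set (xs @ ys)"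
    using min_seq_through_retraction[OF G c' A wA(2) neq''] .
  have "A \<noteq> w A" using neq'' by auto
  then have "w (w' A) = w A"
    using corridor_retractionD(6)[OF c A wA(2) _ _ seq] wA(3) by simp
  moreover have "w (w' A) = w y"
    by (rule retraction_constant_on_disjoint[OF G c c' disj w'A y])
  ultimately show False using neq by simp
qed

text \<open>The product along the concatenated minimal sequence consists of the products along its
  two pieces and the single step from \<open>w A\<close> to \<open>w B\<close> that joins
  them.\<close>

lemma multiplicative_through_retraction:
  assumes G: "connected_digraph V E" and c: "corridor_retraction V E U w"
    and mult: "\<And>A B. A \<in> V \<Longrightarrow> B \<in> V \<Longrightarrow> A \<noteq> B \<Longrightarrow> multiplicative_along_min_seqs V E f A B"
    and one: "\<And>A. A \<in> V \<Longrightarrow> f A A = 1"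
    and A: "A \<in> V" and B: "B \<in> V" and AB: "w A \<noteq> w B"
  shows "f A B = f A (w A) * f (w A) (w B) * f (w B) B"
proof -
  have V: "w A \<in> V" "w B \<in> V" using corridor_retractionD(4)[OF c] A B by simp_all
  \<comment> \<open>The case \<open>X = Y\<close> occurs when \<open>A\<close> or \<open>B\<close>
    is its own retract: the one-vertex sequence has no steps, and the empty product agrees with
    \<open>f X X = 1\<close>.\<close>
  have val: "f X Y = prod_list (step_values f xs)"
    if "X \<in> V" "Y \<in> V" "xs \<in> min_seqs V E X Y" for X Y xs
  proof (cases "X = Y")
    case True
    then show ?thesis using that one by (simp add: min_seqs_def step_values_def)
  next
    case False
    then show ?thesis using that mult[of X Y] by (auto simp: multiplicative_along_min_seqs_def)
  qed
  obtain xs ys where xs: "xs \<in> min_seqs V E A (w A)" and ys: "ys \<in> min_seqs V E (w B) B"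
    and xys: "xs @ ys \<in> min_seqs V E A B"
    using min_seq_through_retraction[OF G c A B AB] .
  have "f A B = prod_list (step_values f (xs @ ys))" using val[OF A B xys] .
  also have "\<dots> = prod_list (step_values f xs) * f (w A) (w B) * prod_list (step_values f ys)"
    using min_seqs_ends[OF xs] min_seqs_ends[OF ys]
    by (simp add: step_values_append mult.assoc)
  finally show ?thesis using val[OF A V(1) xs] val[OF V(2) B ys] by simp
qed

section \<open>Factorisation over the given parts\<close>

theorem theorem1p5:
  fixes V :: "'v set" and E :: "('v \<times> 'v) set" and d :: "'v \<Rightarrow> 'v \<Rightarrow> rpoly"
    and n r s :: nat and U :: "nat \<Rightarrow> 'v set" and P :: "nat \<Rightarrow> 'v set" and q :: "nat \<Rightarrow> rpoly"
  assumes "exp_dist_cat_graph n V E d"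
    and "\<forall>i\<in>{1..r}. U i \<noteq> {} \<and> U i \<subseteq> V \<and> connected_by_corridor V E (U i)"
    and "disjoint_family_on U {1..r}"
    and "s = (\<Sum>i\<in>{1..r}. card (U i)) - r + 1"
    and "indexed_partition V s P"
    and "\<forall>l\<in>{1..s}. (\<exists>i\<in>{1..r}. U i \<inter> P l \<noteq> {}) \<and> (\<forall>i\<in>{1..r}. card (U i \<inter> P l) \<le> 1)"
    and "\<forall>l\<in>{1..s}. min_seq_closed V E (P l)"
    and "\<forall>i\<in>{1..r}. q i \<in> variables n \<and> (\<forall>A\<in>U i. \<forall>B\<in>U i. A \<noteq> B \<longrightarrow> d A B = q i)"
  shows "det_on V (\<lambda>A B. d B A) =
           (\<Prod>i\<in>{1..r}. (1 + of_nat (card (U i) - 1) * q i) * (1 - q i) ^ (card (U i) - 1)) *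
           (\<Prod>k\<in>{1..s}. det_on (P k) (\<lambda>A B. d B A))"
proof -
  let ?I = "{1..r}"
  have G: "connected_digraph V E" and dist: "exponential_distance n V E d"
    using assms(1) by (auto simp: exp_dist_cat_graph_def prob_cat_graph_def)
  have one: "d A A = 1" if "A \<in> V" for A
    using dist that by (simp add: exponential_distance_def)
  have mult: "multiplicative_along_min_seqs V E d A B" if "A \<in> V" "B \<in> V" "A \<noteq> B" for A B
    using dist that by (simp add: exponential_distance_def)
  have V: "finite V" using G by (simp add: connected_digraph_def)
  have cover: "(\<Union>l\<in>{1..s}. P l) = V" using assms(5) by (simp add: indexed_partition_def)
  \<comment> \<open>The summand 1 in \<open>s\<close> guarantees a first part, and parts are
    nonempty.\<close>
  have "P 1 \<noteq> {}" "1 \<in> {1..s}" using assms(4,5) by (auto simp: indexed_partition_def)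
  then have Vne: "V \<noteq> {}" using cover by blast
  have U: "U i \<noteq> {}" "U i \<subseteq> V" if "i \<in> ?I" for i using assms(2) that by auto
  have finU: "finite (U i)" if "i \<in> ?I" for i using U(2)[OF that] V by (rule finite_subset)
  have "\<exists>w. corridor_retraction V E (U i) w" if "i \<in> ?I" for i
    using assms(2) that by (meson corridor_retraction_exists)
  then obtain w where w: "\<And>i. i \<in> ?I \<Longrightarrow> corridor_retraction V E (U i) (w i)"
    by metis
  have wU: "w i A \<in> U i" if "i \<in> ?I" "A \<in> V" for i A
    by (rule corridor_retractionD(3)[OF w[OF that(1)] that(2)])
  have disj: "U i \<inter> U j = {}" if "i \<in> ?I" "j \<in> ?I" "i \<noteq> j" for i j
    using assms(3) that unfolding disjoint_family_on_def by blast
  have wid: "w i c = c" if "i \<in> ?I" "c \<in> U i" for i c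
    by (rule corridor_retractionD(5)[OF w[OF that(1)] that(2)])
  have const: "w j c = w j c'" if "i \<in> ?I" "j \<in> ?I" "i \<noteq> j" "c \<in> U i" "c' \<in> U i" for i j c c'
    by (rule retraction_constant_on_disjoint[OF G w[OF that(2)] w[OF that(1)]
          disj[OF that(2,1) that(3)[symmetric]] that(4,5)])
  have sep: "w i A = w i a"
    if "i \<in> ?I" "j \<in> ?I" "i \<noteq> j" "A \<in> V" "a \<in> U j" "c \<in> U i" "w j A \<noteq> w j c" for i j A a c
    by (rule retraction_separation[OF G w[OF that(2)] w[OF that(1)]
          disj[OF that(2,1) that(3)[symmetric]] that(4-7)])
  \<comment> \<open>The matrix has entry \<open>d B A\<close> in row \<open>A\<close> and column
    \<open>B\<close>, so sequences from \<open>B\<close> to \<open>A\<close> are factored and the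
    outer factors change places.\<close>
  have fac: "d B A = d (w i A) A * q i * d B (w i B)"
    if i: "i \<in> ?I" and AB: "A \<in> V" "B \<in> V" "w i A \<noteq> w i B" for i A B
  proof -
    have "d B A = d B (w i B) * d (w i B) (w i A) * d (w i A) A"
      using multiplicative_through_retraction[OF G w[OF i] mult one AB(2,1)] AB(3) by simp
    moreover have "d (w i B) (w i A) = q i"
      using assms(8) i wU[OF i AB(1)] wU[OF i AB(2)] AB(3) by metis
    ultimately show ?thesis by (simp add: mult_ac)
  qed
  have det: "det_on V (\<lambda>A B. d B A) =
      (\<Prod>i\<in>?I. (1 + of_nat (card (U i) - 1) * q i) * (1 - q i) ^ (card (U i) - 1)) *
      (\<Prod>K\<in>fibre V w ?I ` V. det_on K (\<lambda>A B. d B A))"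
    by (rule det_on_fibres(1)) (fact V Vne finite_atLeastAtMost U wU wid const sep one fac)+
  have "card (fibre V w ?I ` V) = Suc (\<Sum>i\<in>?I. card (U i) - 1)"
    by (rule det_on_fibres(2)[where M = "\<lambda>A B. d B A" and q = q])
       (fact V Vne finite_atLeastAtMost U wU wid const sep one fac)+
  \<comment> \<open>Every \<open>U i\<close> is nonempty and finite, so the truncated subtractions
    are exact.\<close>
  also have "(\<Sum>i\<in>?I. card (U i) - 1) = (\<Sum>i\<in>?I. card (U i)) - r"
  proof -
    have "card (U i) > 0" if "i \<in> ?I" for i using U(1)[OF that] finU[OF that] by (simp add: card_gt_0_iff)
    then have "(\<Sum>i\<in>?I. card (U i) - 1) = (\<Sum>i\<in>?I. card (U i)) - (\<Sum>i\<in>?I. 1)"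
      by (intro sum_subtractf_nat) (fastforce simp: Suc_le_eq)
    then show ?thesis by simp
  qed
  finally have card: "card (fibre V w ?I ` V) = s" using assms(4) by simp
  have "bij_betw P {1..s} (fibre V w ?I ` V)"
  proof (rule indexed_partition_eq_fibres[OF assms(5) card], rule ccontr)
    fix l i A B
    assume l: "l \<in> {1..s}" and i: "i \<in> ?I" and A: "A \<in> P l" and B: "B \<in> P l"
      and neq: "w i A \<noteq> w i B"
    have AV: "A \<in> V" "B \<in> V" using A B l cover by blast+
    obtain xs ys where seq: "xs @ ys \<in> min_seqs V E A B"
      "w i A \<in> set (xs @ ys)" "w i B \<in> set (xs @ ys)"
      using min_seq_through_retraction[OF G w[OF i] AV neq] .
    have "A \<noteq> B" using neq by auto
    \<comment> \<open>Closure of the part under minimal sequences would bring the two different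
      corridor vertices \<open>w i A\<close> and \<open>w i B\<close> into \<open>P l\<close>, which
      may contain at most one vertex of \<open>U i\<close>.\<close>
    then have "set (xs @ ys) \<subseteq> P l"
      using assms(7) l A B seq(1) unfolding min_seq_closed_def by blast
    then have "{w i A, w i B} \<subseteq> U i \<inter> P l"
      using seq wU[OF i AV(1)] wU[OF i AV(2)] by blast
    then have "card {w i A, w i B} \<le> card (U i \<inter> P l)"
      using finU[OF i] by (intro card_mono) auto
    also have "\<dots> \<le> 1" using assms(6) l i by blast
    finally show False using neq by simp
  qed
  then have "(\<Prod>K\<in>fibre V w ?I ` V. det_on K (\<lambda>A B. d B A)) =
      (\<Prod>k\<in>{1..s}. det_on (P k) (\<lambda>A B. d B A))"
    by (rule prod.reindex_bij_betw[symmetric])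
  with det show ?thesis by simp
qed

end
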